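(* Let $G=(V,E,\omega)$ be a connected finite weighted graph, $\mathbb V\in\mathbb R^n$, $h>0$, and let $\mathbb W=(\mathbb W_{jl})_{1\le j,l\le n}$ be a real symmetric positive semidefinite matrix. Let $\Psi^g(t)=\sqrt{\rho^g}\,e^{-i\nu^g t/h}$, with $\rho^g\in\mathcal P_o(G)$ and $\nu^g\in\mathbb R$ time invariant, be an interior stationary solution of the system (GNLS) given in the context (i.e. $\rho(t)\equiv\rho^g$, $S_j(t)=-\nu^g t$ for all $j$ solves it). Then $\Psi^g$ is a ground state, i.e. $$\Psi^g\in\arg\min_\Psi\Big\{\mathcal E(\Psi):\ \sum_{j=1}^n|\Psi_j|^2=1\Big\},$$ with $$\rho^g=\arg\min_{\rho\in\mathcal P(G)}\mathcal E(\sqrt\rho)\qquad\text{and}\qquad \nu^g=\mathcal E(\sqrt{\rho^g})+\mathcal E_{int}(\sqrt{\rho^g}).$$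
   Context: $G=(V,E,\omega)$, $V=\{1,\dots,n\}$, is undirected, connected, without self-loops or multiple edges; $E$ is a set of ordered pairs containing both $(j,l)$ and $(l,j)$ for each edge; $\omega_{jl}=\omega_{lj}>0$ for $(j,l)\in E$; $N(j)=\{l:(j,l)\in E\}$. $\mathcal P(G)=\{\rho\in\mathbb R^n:\sum_j\rho_j=1,\rho_j\ge0\}$, with interior $\mathcal P_o(G)$ (all $\rho_j>0$). $g_{jl}(\rho)=\frac{\rho_j+\rho_l}2$. Discrete Fisher information: $\mathcal I(\rho)=\frac12\sum_{(j,l)\in E}\omega_{jl}(\log\rho_j-\log\rho_l)^2g_{jl}(\rho)$ on $\mathcal P_o(G)$, with $\mathcal I(\rho)=+\infty$ for $\rho\in\mathcal P(G)\setminus\mathcal P_o(G)$; partial derivatives are taken on $(0,\infty)^n$. (GNLS) is the system for $\rho(t)\in\mathcal P_o(G)$, $S(t)\in\mathbb R^n$: for each $j\in V$, $$\frac{d\rho_j}{dt}+\sum_{l\in N(j)}\omega_{jl}(S_l-S_j)g_{jl}(\rho)=0,$$ $$\frac{dS_j}{dt}+\frac12\sum_{l\in N(j)}\omega_{jl}(S_j-S_l)^2\frac{\partial g_{jl}}{\partial\rho_j}+\frac{h^2}8\frac{\partial}{\partial\rho_j}\mathcal I(\rho)+\mathbb V_j+\sum_{l=1}^n\mathbb W_{jl}\rho_l=0,$$ and $\Psi_j=\sqrt{\rho_j}\,e^{iS_j/h}$. Energy: a wave function $\Psi$ is given by $\Psi_j=\sqrt{\rho_j}e^{iS_j/h}$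 with $\rho\in\mathcal P(G)$, $S\in\mathbb R^n$, and $$\mathcal E(\Psi)=\frac14\sum_{(j,l)\in E}\omega_{jl}(S_j-S_l)^2g_{jl}(\rho)+\frac{h^2}8\mathcal I(\rho)+\sum_j\mathbb V_j\rho_j+\frac12\sum_{j,l}\mathbb W_{jl}\rho_j\rho_l,$$ so the minimization over $\Psi$ is over all such $(\rho,S)$. $\sqrt\rho=(\sqrt{\rho_j})_j$ is taken with $S=0$, so $\mathcal E(\sqrt\rho)=\frac{h^2}8\mathcal I(\rho)+\sum_j\mathbb V_j\rho_j+\frac12\sum_{j,l}\mathbb W_{jl}\rho_j\rho_l$; and $\mathcal E_{int}(\sqrt\rho)=\frac12\sum_{j,l}\mathbb W_{jl}\rho_j\rho_l$. *)

theory Defs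
  imports "HOL-Analysis.Analysis" "HOL-Library.Extended_Real"
begin

text \<open>
  The vertex set is the finite index type \<open>'n\<close>. Edges are ordered pairs, both orientations of
  every edge being present; \<open>\<omega>\<close> matters only on \<open>E\<close>.
\<close>

definition weighted_graph :: "('n::finite \<times> 'n) set \<Rightarrow> ('n \<Rightarrow> 'n \<Rightarrow> real) \<Rightarrow> bool" where
  "weighted_graph E \<omega> \<longleftrightarrow>
     sym E \<and> irrefl E \<and> (\<forall>(j, l) \<in> E. \<omega> j l = \<omega> l j \<and> 0 < \<omega> j l)"

definition connected_graph :: "('n::finite \<times> 'n) set \<Rightarrow> bool" where
  "connected_graph E \<longleftrightarrow> (\<forall>j l. (j, l) \<in> E\<^sup>*)"

definition neighbours :: "('n::finite \<times> 'n) set \<Rightarrow> 'n \<Rightarrow> 'n set" where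
  "neighbours E j = {l. (j, l) \<in> E}"

definition prob_simplex :: "(real ^ 'n::finite) set" where
  "prob_simplex = {\<rho>. (\<Sum>j\<in>UNIV. \<rho> $ j) = 1 \<and> (\<forall>j. 0 \<le> \<rho> $ j)}"

definition open_simplex :: "(real ^ 'n::finite) set" where
  "open_simplex = {\<rho> \<in> prob_simplex. \<forall>j. 0 < \<rho> $ j}"

definition edge_avg :: "'n \<Rightarrow> 'n \<Rightarrow> real ^ 'n::finite \<Rightarrow> real" where
  "edge_avg j l \<rho> = (\<rho> $ j + \<rho> $ l) / 2"

definition partial_deriv :: "(real ^ 'n::finite \<Rightarrow> real) \<Rightarrow> 'n \<Rightarrow> real ^ 'n \<Rightarrow> real" where
  "partial_deriv f j \<rho> = deriv (\<lambda>x. f (\<chi> i. if i = j then x else \<rho> $ i)) (\<rho> $ j)"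

text \<open>
  The Fisher information on the open positive orthant, where it is differentiated, and its
  extension by \<open>\<infinity>\<close> to the boundary of the simplex.
\<close>

definition fisher_pos ::
    "('n::finite \<times> 'n) set \<Rightarrow> ('n \<Rightarrow> 'n \<Rightarrow> real) \<Rightarrow> real ^ 'n \<Rightarrow> real" where
  "fisher_pos E \<omega> \<rho> =
     1 / 2 * (\<Sum>(j, l)\<in>E. \<omega> j l * (ln (\<rho> $ j) - ln (\<rho> $ l))\<^sup>2 * edge_avg j l \<rho>)"

definition fisher ::
    "('n::finite \<times> 'n) set \<Rightarrow> ('n \<Rightarrow> 'n \<Rightarrow> real) \<Rightarrow> real ^ 'n \<Rightarrow> ereal" where
  "fisher E \<omega> \<rho> = (if \<forall>j. 0 < \<rho> $ j then ereal (fisher_pos E \<omega> \<rho>) else \<infinity>)"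

definition GNLS_solution ::
    "('n::finite \<times> 'n) set \<Rightarrow> ('n \<Rightarrow> 'n \<Rightarrow> real) \<Rightarrow> real ^ 'n \<Rightarrow> real ^ 'n ^ 'n \<Rightarrow> real \<Rightarrow>
     (real \<Rightarrow> real ^ 'n) \<Rightarrow> (real \<Rightarrow> real ^ 'n) \<Rightarrow> bool" where
  "GNLS_solution E \<omega> V W h \<rho> S \<longleftrightarrow>
     (\<forall>t. \<rho> t \<in> open_simplex \<and>
       (\<forall>j.
         (\<exists>\<rho>'. ((\<lambda>s. \<rho> s $ j) has_real_derivative \<rho>') (at t) \<and>
            \<rho>' + (\<Sum>l\<in>neighbours E j. \<omega> j l * (S t $ l - S t $ j) * edge_avg j l (\<rho> t)) = 0) \<and>
         (\<exists>S'. ((\<lambda>s. S s $ j) has_real_derivative S') (at t) \<and>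
            S' + 1 / 2 * (\<Sum>l\<in>neighbours E j.
                   \<omega> j l * (S t $ j - S t $ l)\<^sup>2 * partial_deriv (edge_avg j l) j (\<rho> t))
               + h\<^sup>2 / 8 * partial_deriv (fisher_pos E \<omega>) j (\<rho> t)
               + V $ j + (\<Sum>l\<in>UNIV. W $ j $ l * \<rho> t $ l) = 0)))"

definition wave_function :: "real \<Rightarrow> real ^ 'n::finite \<Rightarrow> real ^ 'n \<Rightarrow> complex ^ 'n" where
  "wave_function h \<rho> S = (\<chi> j. complex_of_real (sqrt (\<rho> $ j)) * exp (\<i> * complex_of_real (S $ j / h)))"

definition interaction_energy :: "real ^ 'n ^ 'n \<Rightarrow> real ^ 'n::finite \<Rightarrow> real" where
  "interaction_energy W \<rho> = 1 / 2 * (\<Sum>j\<in>UNIV. \<Sum>l\<in>UNIV. W $ j $ l * \<rho> $ j * \<rho> $ l)"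

text \<open>
  The energy is a function of the pair \<open>(\<rho>, S)\<close>, not of the complex vector
  \<open>wave_function h \<rho> S\<close>: changing a single \<open>S $ j\<close> by \<open>2 * pi * h\<close> preserves the latter but
  not the energy.
\<close>

definition energy ::
    "('n::finite \<times> 'n) set \<Rightarrow> ('n \<Rightarrow> 'n \<Rightarrow> real) \<Rightarrow> real ^ 'n \<Rightarrow> real ^ 'n ^ 'n \<Rightarrow> real \<Rightarrow>
     real ^ 'n \<Rightarrow> real ^ 'n \<Rightarrow> ereal" where
  "energy E \<omega> V W h \<rho> S =
     ereal (1 / 4 * (\<Sum>(j, l)\<in>E. \<omega> j l * (S $ j - S $ l)\<^sup>2 * edge_avg j l \<rho>))
     + ereal (h\<^sup>2 / 8) * fisher E \<omega> \<rho>
     + ereal (\<Sum>j\<in>UNIV. V $ j * \<rho> $ j)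
     + ereal (interaction_energy W \<rho>)"

definition sqrt_energy ::
    "('n::finite \<times> 'n) set \<Rightarrow> ('n \<Rightarrow> 'n \<Rightarrow> real) \<Rightarrow> real ^ 'n \<Rightarrow> real ^ 'n ^ 'n \<Rightarrow> real \<Rightarrow>
     real ^ 'n \<Rightarrow> ereal" where
  "sqrt_energy E \<omega> V W h \<rho> = energy E \<omega> V W h \<rho> 0"

definition ground_state ::
    "('n::finite \<times> 'n) set \<Rightarrow> ('n \<Rightarrow> 'n \<Rightarrow> real) \<Rightarrow> real ^ 'n \<Rightarrow> real ^ 'n ^ 'n \<Rightarrow> real \<Rightarrow>
     real ^ 'n \<Rightarrow> real ^ 'n \<Rightarrow> bool" where
  "ground_state E \<omega> V W h \<rho> S \<longleftrightarrow>
     is_arg_min (\<lambda>(\<rho>, S). energy E \<omega> V W h \<rho> S)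
       (\<lambda>(\<rho>, S). \<rho> \<in> prob_simplex \<and> (\<Sum>j\<in>UNIV. (cmod (wave_function h \<rho> S $ j))\<^sup>2) = 1)
       (\<rho>, S)"

definition pos_semidef :: "real ^ 'n ^ 'n::finite \<Rightarrow> bool" where
  "pos_semidef A \<longleftrightarrow> (\<forall>x. 0 \<le> x \<bullet> (A *v x))"

end

theory Submission
  imports Defs
begin

text \<open>
  The edge function \<open>(ln x - ln y)\<^sup>2 (x + y) / 2\<close> is the perspective \<open>y \<phi> (x / y)\<close> of the strictly
  convex \<open>\<phi> r = (ln r)\<^sup>2 (r + 1) / 2\<close>. So the Fisher information is convex and homogeneous of
  degree one: it lies above its tangent at \<open>\<rho>g\<close>, which is linear, and touches it only where
  \<open>\<rho>\<close> is proportional to \<open>\<rho>g\<close> along every edge. By connectedness this happens in the simplex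
  only at \<open>\<rho>g\<close>. Pairing the stationarity equation with \<open>\<rho>g\<close> gives \<open>\<nu>g\<close> by Euler's identity;
  pairing it with \<open>\<rho>\<close> evaluates the tangent, and the interaction energy is convex because \<open>W\<close> is
  positive semidefinite.
\<close>

text \<open>The derivative \<open>\<phi>'\<close> is strictly increasing, so the mean value theorem
  on either side of \<open>s\<close> puts the graph strictly above its tangent there.\<close>

lemma strict_convex_log_square:
  fixes r s :: real
  assumes "0 < r" "0 < s" "r \<noteq> s"
  shows "(ln s)\<^sup>2 * (s + 1) / 2 + (ln s + ln s / s + (ln s)\<^sup>2 / 2) * (r - s)
    < (ln r)\<^sup>2 * (r + 1) / 2"
proof -
  define \<phi> where "\<phi> = (\<lambda>x::real. (ln x)\<^sup>2 * (x + 1) / 2)"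
  define \<phi>' where "\<phi>' = (\<lambda>x::real. ln x + ln x / x + (ln x)\<^sup>2 / 2)"
  have d1: "(\<phi> has_real_derivative \<phi>' x) (at x)" if "0 < x" for x
    unfolding \<phi>_def \<phi>'_def using that
    by (auto intro!: derivative_eq_intros simp: field_simps power2_eq_square)
  have d2: "(\<phi>' has_real_derivative (x + 1 + (x - 1) * ln x) / x\<^sup>2) (at x)" if "0 < x" for x
    unfolding \<phi>'_def using that
    by (auto intro!: derivative_eq_intros simp: field_simps power2_eq_square)
  have pos: "0 < (x + 1 + (x - 1) * ln x) / x\<^sup>2" if "0 < x" for x :: real
  proof -
    \<comment> \<open>Both factors change sign at 1.\<close>
    have "0 \<le> (x - 1) * ln x"
      using that by (cases "1 \<le> x") (auto intro: mult_nonpos_nonpos)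
    then show ?thesis using that by simp
  qed
  have mono: "\<phi>' x < \<phi>' y" if "0 < x" "x < y" for x y
    using DERIV_pos_imp_increasing[OF \<open>x < y\<close>, of \<phi>'] d2 pos that(1)
    by (meson less_le_trans)
  have "\<phi> s + \<phi>' s * (r - s) < \<phi> r"
  proof (cases "s < r")
    case True
    obtain z where z: "s < z" "z < r" "\<phi> r - \<phi> s = (r - s) * \<phi>' z"
      using MVT2[OF True, of \<phi> \<phi>'] d1 assms by force
    have "\<phi>' s * (r - s) < \<phi>' z * (r - s)"
      using mono[OF \<open>0 < s\<close> z(1)] True by simp
    then show ?thesis using z(3) by (simp add: mult.commute)
  next
    case False
    then have rs: "r < s" using assms by simp
    obtain z where z: "r < z" "z < s" "\<phi> s - \<phi> r = (s - r) * \<phi>' z"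
      using MVT2[OF rs, of \<phi> \<phi>'] d1 assms by force
    have "\<phi>' z * (s - r) < \<phi>' s * (s - r)"
      using mono[OF _ z(2)] z(1) rs assms(1) by simp
    then show ?thesis using z(3) by (simp add: algebra_simps)
  qed
  then show ?thesis by (simp add: \<phi>_def \<phi>'_def)
qed

section \<open>The edge function and its tangent planes\<close>

definition edge_info :: "real \<Rightarrow> real \<Rightarrow> real" where
  "edge_info x y = (ln x - ln y)\<^sup>2 * ((x + y) / 2)"

text \<open>This is the derivative in the first argument; by symmetry
  \<open>edge_info_deriv y x\<close> is the one in the second.\<close>

definition edge_info_deriv :: "real \<Rightarrow> real \<Rightarrow> real" where
  "edge_info_deriv x y = (ln x - ln y) * (x + y) / x + (ln x - ln y)\<^sup>2 / 2"

lemma edge_info_sym: "edge_info x y = edge_info y x"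
  by (simp add: edge_info_def power2_commute add.commute)

lemma edge_info_diag [simp]: "edge_info x x = 0"
  by (simp add: edge_info_def)

lemma edge_info_deriv_diag [simp]: "edge_info_deriv x x = 0"
  by (simp add: edge_info_deriv_def)

lemma DERIV_edge_info:
  assumes "0 < x"
  shows "((\<lambda>x. edge_info x y) has_real_derivative edge_info_deriv x y) (at x)"
  unfolding edge_info_def edge_info_deriv_def using assms
  by (auto intro!: derivative_eq_intros simp: field_simps power2_eq_square)

text \<open>Euler's identity in degree one: the tangent plane at \<open>(a, b)\<close> passes
  through the origin and has no constant term.\<close>

lemma edge_info_euler:
  assumes "0 < a" "0 < b"
  shows "edge_info_deriv a b * a + edge_info_deriv b a * b = edge_info a b"
  using assms by (simp add: edge_info_def edge_info_deriv_def field_simps power2_eq_square)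

text \<open>The one-variable tangent inequality at \<open>a / b\<close>, evaluated at
  \<open>x / y\<close>, turns into this one after multiplication by \<open>y\<close>. The last
  hypothesis says that \<open>(x, y)\<close> lies off the ray through \<open>(a, b)\<close>.\<close>

lemma edge_info_gt_tangent:
  assumes "0 < a" "0 < b" "0 < x" "0 < y" "x * b \<noteq> y * a"
  shows "edge_info_deriv a b * x + edge_info_deriv b a * y < edge_info x y"
proof -
  let ?r = "x / y" and ?s = "a / b"
  define L where "L = ln a - ln b"
  have L: "ln ?s = L" "ln ?r = ln x - ln y" using assms by (simp_all add: L_def ln_div)
  have rs: "?r \<noteq> ?s" using assms by (simp add: frac_eq_eq mult.commute[of a])
  have "L\<^sup>2 * (?s + 1) / 2 + (L + L / ?s + L\<^sup>2 / 2) * (?r - ?s) < (ln x - ln y)\<^sup>2 * (?r + 1) / 2"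
    using strict_convex_log_square[of ?r ?s, unfolded L] rs assms(1-4) divide_pos_pos by blast
  then have "y * (L\<^sup>2 * (?s + 1) / 2 + (L + L / ?s + L\<^sup>2 / 2) * (?r - ?s))
      < y * ((ln x - ln y)\<^sup>2 * (?r + 1) / 2)"
    using assms(4) by (rule mult_strict_left_mono)
  moreover have "y * (L\<^sup>2 * (?s + 1) / 2 + (L + L / ?s + L\<^sup>2 / 2) * (?r - ?s))
      = edge_info_deriv a b * x + edge_info_deriv b a * y"
  proof -
    have D: "edge_info_deriv a b = L * (a + b) / a + L\<^sup>2 / 2"
      "edge_info_deriv b a = - L * (a + b) / b + L\<^sup>2 / 2"
      by (simp_all add: edge_info_deriv_def L_def power2_commute minus_divide_left algebra_simps)
    show ?thesis
      unfolding D using assms(1-4) by (simp add: field_simps power2_eq_square)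
  qed
  moreover have "y * ((ln x - ln y)\<^sup>2 * (?r + 1) / 2) = edge_info x y"
    using assms by (simp add: edge_info_def field_simps)
  ultimately show ?thesis by simp
qed

lemma edge_info_ge_tangent:
  assumes "0 < a" "0 < b" "0 < x" "0 < y"
  shows "edge_info_deriv a b * x + edge_info_deriv b a * y \<le> edge_info x y"
proof (cases "x * b = y * a")
  case True
  define c where "c = x / a"
  have c: "0 < c" "x = c * a" "y = c * b" using assms True by (auto simp: c_def field_simps)
  \<comment> \<open>On the ray equality holds: the factor \<open>c\<close> cancels in the difference
    of logarithms and survives only in the average.\<close>
  have "edge_info x y = c * edge_info a b"
    using assms c(1) by (simp add: c(2,3) edge_info_def ln_mult algebra_simps)
  also have "edge_info a b = edge_info_deriv a b * a + edge_info_deriv b a * b"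
    using edge_info_euler assms by simp
  finally show ?thesis by (simp add: c algebra_simps)
next
  case False
  then show ?thesis using edge_info_gt_tangent[OF assms] by simp
qed

section \<open>Tangent of the Fisher information\<close>

definition fisher_tangent ::
    "('n::finite \<times> 'n) set \<Rightarrow> ('n \<Rightarrow> 'n \<Rightarrow> real) \<Rightarrow> real ^ 'n \<Rightarrow> real ^ 'n \<Rightarrow> real" where
  "fisher_tangent E \<omega> \<sigma> \<rho> = 1 / 2 * (\<Sum>(j, l)\<in>E. \<omega> j l *
     (edge_info_deriv (\<sigma> $ j) (\<sigma> $ l) * \<rho> $ j + edge_info_deriv (\<sigma> $ l) (\<sigma> $ j) * \<rho> $ l))"

lemma fisher_pos_edge_info:
  "fisher_pos E \<omega> \<rho> = 1 / 2 * (\<Sum>(j, l)\<in>E. \<omega> j l * edge_info (\<rho> $ j) (\<rho> $ l))"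
  by (simp add: fisher_pos_def edge_info_def edge_avg_def mult.assoc)

lemma fisher_tangent_self:
  assumes "\<And>j. 0 < \<sigma> $ j"
  shows "fisher_tangent E \<omega> \<sigma> \<sigma> = fisher_pos E \<omega> \<sigma>"
  using assms by (simp add: fisher_tangent_def fisher_pos_edge_info edge_info_euler)

text \<open>Every edge contributes a weak inequality, and one edge with unequal ratios makes the sum
  strict because its weight is positive.\<close>

lemma fisher_tangent_less:
  assumes "weighted_graph E \<omega>" "\<And>j. 0 < \<sigma> $ j" "\<And>j. 0 < \<rho> $ j"
    and "(j, l) \<in> E" "\<rho> $ j * \<sigma> $ l \<noteq> \<rho> $ l * \<sigma> $ j"
  shows "fisher_tangent E \<omega> \<sigma> \<rho> < fisher_pos E \<omega> \<rho>"
proof -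
  have \<omega>: "0 < \<omega> j l" if "(j, l) \<in> E" for j l
    using assms(1) that unfolding weighted_graph_def by blast
  have "(\<Sum>(j, l)\<in>E. \<omega> j l *
      (edge_info_deriv (\<sigma> $ j) (\<sigma> $ l) * \<rho> $ j + edge_info_deriv (\<sigma> $ l) (\<sigma> $ j) * \<rho> $ l))
      < (\<Sum>(j, l)\<in>E. \<omega> j l * edge_info (\<rho> $ j) (\<rho> $ l))"
  proof (intro sum_strict_mono_ex1 ballI bexI[OF _ assms(4)])
    show "(case p of (j, l) \<Rightarrow> \<omega> j l *
        (edge_info_deriv (\<sigma> $ j) (\<sigma> $ l) * \<rho> $ j + edge_info_deriv (\<sigma> $ l) (\<sigma> $ j) * \<rho> $ l))
        \<le> (case p of (j, l) \<Rightarrow> \<omega> j l * edge_info (\<rho> $ j) (\<rho> $ l))" if "p \<in> E" for p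
      using that
      by (auto split: prod.split intro!: mult_left_mono edge_info_ge_tangent assms(2,3) less_imp_le[OF \<omega>])
    show "(case (j, l) of (j, l) \<Rightarrow> \<omega> j l *
        (edge_info_deriv (\<sigma> $ j) (\<sigma> $ l) * \<rho> $ j + edge_info_deriv (\<sigma> $ l) (\<sigma> $ j) * \<rho> $ l))
        < (case (j, l) of (j, l) \<Rightarrow> \<omega> j l * edge_info (\<rho> $ j) (\<rho> $ l))"
      using edge_info_gt_tangent[OF assms(2,2,3,3,5)] \<omega>[OF assms(4)] by simp
  qed simp
  then show ?thesis
    unfolding fisher_tangent_def fisher_pos_edge_info by simp
qed

text \<open>The ratio of the two densities is constant along paths, hence globally, and equal total
  masses force it to be 1.\<close>

lemma connected_graph_proportional:
  assumes "connected_graph E" "\<rho> \<in> prob_simplex" "\<sigma> \<in> prob_simplex" "\<And>j. 0 < \<sigma> $ j"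
    and "\<And>j l. (j, l) \<in> E \<Longrightarrow> \<rho> $ j * \<sigma> $ l = \<rho> $ l * \<sigma> $ j"
  shows "\<rho> = \<sigma>"
proof -
  have \<sigma>0: "\<sigma> $ j \<noteq> 0" for j using assms(4)[of j] by simp
  have ratio: "\<rho> $ j / \<sigma> $ j = \<rho> $ l / \<sigma> $ l" for j l
  proof -
    have "(j, l) \<in> E\<^sup>*" using assms(1) by (simp add: connected_graph_def)
    then show ?thesis
    proof (induction rule: rtrancl_induct)
      case (step k l)
      have "\<rho> $ k / \<sigma> $ k = \<rho> $ l / \<sigma> $ l"
        using assms(5)[OF step(2)] \<sigma>0 by (simp add: frac_eq_eq)
      with step.IH show ?case by simp
    qed simp
  qed
  \<comment> \<open>Here \<open>undefined\<close> is merely some vertex; by \<open>ratio\<close> the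
    choice does not matter.\<close>
  define c where "c = \<rho> $ undefined / \<sigma> $ undefined"
  have \<rho>: "\<rho> $ j = c * \<sigma> $ j" for j
    using ratio[of j undefined] \<sigma>0[of j] by (simp add: c_def[symmetric] field_simps)
  have "c * (\<Sum>j\<in>UNIV. \<sigma> $ j) = (\<Sum>j\<in>UNIV. \<rho> $ j)"
    by (simp add: \<rho> sum_distrib_left)
  then have "c = 1" using assms(2,3) by (simp add: prob_simplex_def)
  then show ?thesis using \<rho> by (simp add: vec_eq_iff)
qed

text \<open>Since \<open>E\<close> consists of ordered pairs, \<open>j\<close> can be either
  endpoint of a pair, whence the two conditional terms.\<close>

lemma partial_deriv_fisher_pos:
  assumes "\<And>j. 0 < \<sigma> $ j"
  shows "partial_deriv (fisher_pos E \<omega>) j \<sigma> = 1 / 2 * (\<Sum>(k, l)\<in>E. \<omega> k l *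
     ((if k = j then edge_info_deriv (\<sigma> $ k) (\<sigma> $ l) else 0)
      + (if l = j then edge_info_deriv (\<sigma> $ l) (\<sigma> $ k) else 0)))"
proof -
  let ?u = "\<lambda>x i. if i = j then x else \<sigma> $ i"
  let ?D = "\<lambda>k l. (if k = j then edge_info_deriv (\<sigma> $ k) (\<sigma> $ l) else 0)
      + (if l = j then edge_info_deriv (\<sigma> $ l) (\<sigma> $ k) else 0)"
  \<comment> \<open>Symmetry handles \<open>j\<close> as second endpoint; for
    \<open>k = l = j\<close> both the function and the claimed derivative vanish.\<close>
  have edge: "((\<lambda>x. edge_info (?u x k) (?u x l)) has_real_derivative ?D k l) (at (\<sigma> $ j))" for k l
    using DERIV_edge_info[OF assms[of j]]
    by (cases "k = j"; cases "l = j") (auto simp: edge_info_sym[of "\<sigma> $ k"])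
  have "((\<lambda>x. fisher_pos E \<omega> (\<chi> i. ?u x i)) has_real_derivative
      1 / 2 * (\<Sum>p\<in>E. \<omega> (fst p) (snd p) * ?D (fst p) (snd p))) (at (\<sigma> $ j))"
    unfolding fisher_pos_edge_info case_prod_beta vec_lambda_beta
    by (intro DERIV_cmult DERIV_sum edge)
  then show ?thesis
    unfolding partial_deriv_def by (simp add: DERIV_imp_deriv case_prod_beta)
qed

text \<open>After exchanging the sums over vertices and edges, each conditional term selects one
  endpoint.\<close>

lemma sum_partial_deriv_fisher_pos:
  assumes "\<And>j. 0 < \<sigma> $ j"
  shows "(\<Sum>j\<in>UNIV. partial_deriv (fisher_pos E \<omega>) j \<sigma> * \<rho> $ j) = fisher_tangent E \<omega> \<sigma> \<rho>"
proof -
  have "(\<Sum>j\<in>UNIV. \<omega> k l * ((if k = j then a else 0) + (if l = j then b else 0)) * \<rho> $ j)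
      = \<omega> k l * (a * \<rho> $ k + b * \<rho> $ l)" for k l and a b :: real
  proof -
    have "(\<Sum>j\<in>UNIV. \<omega> k l * ((if k = j then a else 0) + (if l = j then b else 0)) * \<rho> $ j)
        = (\<Sum>j\<in>UNIV. (if k = j then \<omega> k l * a * \<rho> $ j else 0)
            + (if l = j then \<omega> k l * b * \<rho> $ j else 0))"
      by (intro sum.cong) (auto simp: algebra_simps)
    then show ?thesis by (simp add: sum.distrib algebra_simps)
  qed
  then show ?thesis
    unfolding partial_deriv_fisher_pos[OF assms] fisher_tangent_def
    by (simp add: sum_divide_distrib[symmetric] sum_distrib_right sum.swap[of _ E] case_prod_beta)
qed

section \<open>Convexity of the interaction energy\<close>

lemma inner_matrix_vector_sum:
  "x \<bullet> (A *v y) = (\<Sum>j\<in>UNIV. \<Sum>l\<in>UNIV. A $ j $ l * x $ j * y $ l)"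
  for A :: "real ^ 'n::finite ^ 'n"
  by (simp add: inner_vec_def matrix_vector_mult_def sum_distrib_left algebra_simps)

lemma interaction_energy_inner: "interaction_energy W \<rho> = (\<rho> \<bullet> (W *v \<rho>)) / 2"
  by (simp add: interaction_energy_def inner_matrix_vector_sum)

text \<open>Expand the nonnegative quadratic form at \<open>\<rho> - \<sigma>\<close>; symmetry of
  \<open>W\<close> merges the two cross terms.\<close>

lemma pos_semidef_tangent_le:
  fixes W :: "real ^ 'n::finite ^ 'n"
  assumes "transpose W = W" "pos_semidef W"
  shows "\<rho> \<bullet> (W *v \<sigma>) \<le> interaction_energy W \<rho> + interaction_energy W \<sigma>"
proof -
  have "\<sigma> \<bullet> (W *v \<rho>) = \<rho> \<bullet> (W *v \<sigma>)"
    by (metis assms(1) dot_lmul_matrix inner_commute vector_transpose_matrix)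
  moreover have "0 \<le> (\<rho> - \<sigma>) \<bullet> (W *v (\<rho> - \<sigma>))"
    using assms(2) by (simp add: pos_semidef_def)
  ultimately show ?thesis
    by (simp add: interaction_energy_inner matrix_vector_mult_diff_distrib inner_diff_left
        inner_diff_right)
qed

section \<open>Stationarity and the energy\<close>

text \<open>The phase is the same at all vertices, so the kinetic sum vanishes, and its time
  derivative is \<open>- \<nu>\<close>.\<close>

lemma stationary_equation:
  assumes "GNLS_solution E \<omega> V W h (\<lambda>t. \<sigma>) (\<lambda>t. \<chi> j. - \<nu> * t)"
  shows "h\<^sup>2 / 8 * partial_deriv (fisher_pos E \<omega>) j \<sigma> + V $ j + (W *v \<sigma>) $ j = \<nu>"
proof -
  obtain S' where S': "((\<lambda>s. - \<nu> * s) has_real_derivative S') (at 0)"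
    "S' + h\<^sup>2 / 8 * partial_deriv (fisher_pos E \<omega>) j \<sigma> + V $ j + (W *v \<sigma>) $ j = 0"
    using assms unfolding GNLS_solution_def matrix_vector_mult_def by simp metis
  have "((\<lambda>s. - \<nu> * s) has_real_derivative - \<nu>) (at 0)"
    by (auto intro!: derivative_eq_intros)
  with S' show ?thesis using DERIV_unique by fastforce
qed

lemma sqrt_energy_interior:
  assumes "\<And>j. 0 < \<rho> $ j"
  shows "sqrt_energy E \<omega> V W h \<rho>
    = ereal (h\<^sup>2 / 8 * fisher_pos E \<omega> \<rho> + V \<bullet> \<rho> + interaction_energy W \<rho>)"
  using assms by (simp add: sqrt_energy_def energy_def fisher_def inner_vec_def)

text \<open>Positivity of \<open>h\<close> keeps the Fisher term infinite, and all other terms are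
  finite.\<close>

lemma sqrt_energy_boundary:
  assumes "0 < h" "\<not> (\<forall>j. 0 < \<rho> $ j)"
  shows "sqrt_energy E \<omega> V W h \<rho> = \<infinity>"
  unfolding sqrt_energy_def energy_def fisher_def if_not_P[OF assms(2)] using assms(1) by simp

lemma energy_const_phase: "energy E \<omega> V W h \<rho> (\<chi> j. c) = sqrt_energy E \<omega> V W h \<rho>"
  by (simp add: sqrt_energy_def energy_def)

text \<open>The kinetic term is nonnegative, which reduces minimization over
  \<open>(\<rho>, S)\<close> to minimization over \<open>\<rho>\<close>.\<close>

lemma sqrt_energy_le_energy:
  assumes "weighted_graph E \<omega>" "\<rho> \<in> prob_simplex"
  shows "sqrt_energy E \<omega> V W h \<rho> \<le> energy E \<omega> V W h \<rho> S"
proof -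
  have "0 \<le> (\<Sum>(j, l)\<in>E. \<omega> j l * (S $ j - S $ l)\<^sup>2 * edge_avg j l \<rho>)"
    using assms unfolding weighted_graph_def prob_simplex_def edge_avg_def
    by (intro sum_nonneg) (fastforce intro!: mult_nonneg_nonneg)
  then show ?thesis
    unfolding sqrt_energy_def energy_def by (intro add_right_mono) simp
qed

lemma wave_function_mass:
  assumes "\<rho> \<in> prob_simplex"
  shows "(\<Sum>j\<in>UNIV. (cmod (wave_function h \<rho> S $ j))\<^sup>2) = 1"
  using assms by (simp add: wave_function_def norm_mult prob_simplex_def)

text \<open>Weight the stationary equation at \<open>j\<close> by \<open>\<rho> $ j\<close> and sum;
  unit mass leaves \<open>\<nu>\<close>. The left side is thus constant on the simplex.\<close>

lemma stationary_pairing: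
  assumes "\<And>j. 0 < \<sigma> $ j" "GNLS_solution E \<omega> V W h (\<lambda>t. \<sigma>) (\<lambda>t. \<chi> j. - \<nu> * t)"
    and "\<rho> \<in> prob_simplex"
  shows "h\<^sup>2 / 8 * fisher_tangent E \<omega> \<sigma> \<rho> + V \<bullet> \<rho> + \<rho> \<bullet> (W *v \<sigma>) = \<nu>"
proof -
  have "\<nu> = (\<Sum>j\<in>UNIV. \<nu> * \<rho> $ j)"
    using assms(3) by (simp add: prob_simplex_def flip: sum_distrib_left)
  also have "\<dots> = (\<Sum>j\<in>UNIV. h\<^sup>2 / 8 * (partial_deriv (fisher_pos E \<omega>) j \<sigma> * \<rho> $ j)
      + V $ j * \<rho> $ j + \<rho> $ j * (W *v \<sigma>) $ j)"
  proof (intro sum.cong refl)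
    show "\<nu> * \<rho> $ j = h\<^sup>2 / 8 * (partial_deriv (fisher_pos E \<omega>) j \<sigma> * \<rho> $ j)
      + V $ j * \<rho> $ j + \<rho> $ j * (W *v \<sigma>) $ j" for j
      by (subst stationary_equation[OF assms(2), of j, symmetric]) (simp add: algebra_simps)
  qed
  finally show ?thesis
    by (simp add: sum.distrib inner_vec_def sum_partial_deriv_fisher_pos[OF assms(1)]
        flip: sum_distrib_left sum_divide_distrib)
qed

lemma stationary_strict_min:
  assumes "weighted_graph E \<omega>" "connected_graph E" "0 < h"
    and "transpose W = W" "pos_semidef W" "\<sigma> \<in> open_simplex"
    and "GNLS_solution E \<omega> V W h (\<lambda>t. \<sigma>) (\<lambda>t. \<chi> j. - \<nu> * t)"
    and "\<rho> \<in> prob_simplex" "\<rho> \<noteq> \<sigma>"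
  shows "sqrt_energy E \<omega> V W h \<sigma> < sqrt_energy E \<omega> V W h \<rho>"
proof (cases "\<forall>j. 0 < \<rho> $ j")
  case True
  have \<sigma>: "\<sigma> \<in> prob_simplex" "\<And>j. 0 < \<sigma> $ j" using assms(6) by (auto simp: open_simplex_def)
  obtain j l where "(j, l) \<in> E" "\<rho> $ j * \<sigma> $ l \<noteq> \<rho> $ l * \<sigma> $ j"
    using connected_graph_proportional[OF assms(2,8) \<sigma>] assms(9) by blast
  then have "fisher_tangent E \<omega> \<sigma> \<rho> < fisher_pos E \<omega> \<rho>"
    using fisher_tangent_less[OF assms(1)] \<sigma>(2) True by blast
  then have "h\<^sup>2 / 8 * fisher_tangent E \<omega> \<sigma> \<rho> < h\<^sup>2 / 8 * fisher_pos E \<omega> \<rho>"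
    using assms(3) by simp
  \<comment> \<open>Both sides equal \<open>\<nu>\<close>, by pairing with \<open>\<rho>\<close> and
    with \<open>\<sigma>\<close> itself.\<close>
  moreover have "h\<^sup>2 / 8 * fisher_tangent E \<omega> \<sigma> \<rho> + V \<bullet> \<rho> + \<rho> \<bullet> (W *v \<sigma>)
      = h\<^sup>2 / 8 * fisher_pos E \<omega> \<sigma> + V \<bullet> \<sigma> + 2 * interaction_energy W \<sigma>"
    using stationary_pairing[OF \<sigma>(2) assms(7,8)] stationary_pairing[OF \<sigma>(2) assms(7) \<sigma>(1)]
    by (simp add: fisher_tangent_self[OF \<sigma>(2)] interaction_energy_inner)
  moreover note pos_semidef_tangent_le[OF assms(4,5), of \<rho> \<sigma>]
  ultimately show ?thesis
    using True \<sigma>(2) by (simp add: sqrt_energy_interior)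
next
  case False
  then show ?thesis
    using assms(3,6) by (simp add: sqrt_energy_boundary sqrt_energy_interior open_simplex_def)
qed

theorem corollary7:
  fixes E :: "('n::finite \<times> 'n) set" and \<omega> :: "'n \<Rightarrow> 'n \<Rightarrow> real"
    and V :: "real ^ 'n" and W :: "real ^ 'n ^ 'n" and h :: real
    and \<rho>g :: "real ^ 'n" and \<nu>g :: real
    and Sg :: "real \<Rightarrow> real ^ 'n" and \<Psi>g :: "real \<Rightarrow> complex ^ 'n"
  assumes "weighted_graph E \<omega>" and "connected_graph E"
    and "0 < h"
    and "transpose W = W" and "pos_semidef W"
    and "\<rho>g \<in> open_simplex"
    and "\<And>t. Sg t = (\<chi> j. - \<nu>g * t)"
    and "\<And>t. \<Psi>g t = (\<chi> j. complex_of_real (sqrt (\<rho>g $ j)) * exp (- \<i> * complex_of_real (\<nu>g * t / h)))"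
    and "GNLS_solution E \<omega> V W h (\<lambda>t. \<rho>g) Sg"
  shows "(\<forall>t. \<Psi>g t = wave_function h \<rho>g (Sg t) \<and> ground_state E \<omega> V W h \<rho>g (Sg t))
    \<and> {\<rho>. is_arg_min (sqrt_energy E \<omega> V W h) (\<lambda>\<rho>. \<rho> \<in> prob_simplex) \<rho>} = {\<rho>g}
    \<and> ereal \<nu>g = sqrt_energy E \<omega> V W h \<rho>g + ereal (interaction_energy W \<rho>g)"
proof -
  have \<sigma>: "\<rho>g \<in> prob_simplex" "\<And>j. 0 < \<rho>g $ j" using assms(6) by (auto simp: open_simplex_def)
  have Sg: "Sg = (\<lambda>t. \<chi> j. - \<nu>g * t)" using assms(7) by blast
  note sol = assms(9)[unfolded Sg]
  note strict = stationary_strict_min[OF assms(1-6) sol]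
  have le: "sqrt_energy E \<omega> V W h \<rho>g \<le> sqrt_energy E \<omega> V W h \<rho>" if "\<rho> \<in> prob_simplex" for \<rho>
    using strict[OF that] by (cases "\<rho> = \<rho>g") auto
  have "\<Psi>g t = wave_function h \<rho>g (Sg t)" for t
    by (simp add: assms(7,8) wave_function_def)
  moreover have "ground_state E \<omega> V W h \<rho>g (Sg t)" for t
  proof -
    \<comment> \<open>At each time \<open>Sg t\<close> is constant over the vertices, so the energy
      of the stationary state is \<open>sqrt_energy\<close> at \<open>\<rho>g\<close>.\<close>
    have "energy E \<omega> V W h \<rho>g (Sg t) \<le> energy E \<omega> V W h \<rho> S" if "\<rho> \<in> prob_simplex" for \<rho> S
      using le[OF that] sqrt_energy_le_energy[OF assms(1) that]
      unfolding Sg energy_const_phase by (rule order_trans)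
    then show ?thesis
      using \<sigma>(1) by (auto simp: ground_state_def is_arg_min_def wave_function_mass not_less)
  qed
  moreover have "{\<rho>. is_arg_min (sqrt_energy E \<omega> V W h) (\<lambda>\<rho>. \<rho> \<in> prob_simplex) \<rho>} = {\<rho>g}"
    using \<sigma>(1) le strict by (auto simp: is_arg_min_def not_less[symmetric])
  \<comment> \<open>Pairing with \<open>\<rho>g\<close> itself produces the quadratic form of
    \<open>W\<close> in full, one interaction energy more than the total energy contains.\<close>
  moreover have "ereal \<nu>g = sqrt_energy E \<omega> V W h \<rho>g + ereal (interaction_energy W \<rho>g)"
    using stationary_pairing[OF \<sigma>(2) sol \<sigma>(1)]
    by (simp add: sqrt_energy_interior[OF \<sigma>(2)] fisher_tangent_self[OF \<sigma>(2)]
        interaction_energy_inner)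
  ultimately show ?thesis by blast
qed

end
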